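(* Let $n_1,n_2\ge 1$ be integers. The number of acyclic orientations of the complete bipartite graph $K_{n_1,n_2}$ is equal to the number of $n_1\times n_2$ lonesum matrices.
   Context: An acyclic orientation of a graph is an assignment of a direction to each edge such that the resulting directed graph has no directed cycles. $K_{n_1,n_2}$ is the complete bipartite graph with parts of sizes $n_1$ and $n_2$. A matrix with entries in $\{0,1\}$ is a lonesum matrix if it is uniquely determined, among zero-one matrices of the same size, by its row sums and column sums. *)

theory Defs
  imports "Graph_Theory.Kuratowski" "Jordan_Normal_Form.Matrix"
begin

text \<open>
  As in the Graph_Theory library, an undirected graph \<open>G\<close> is a symmetric digraph: an edge between
  \<open>u\<close> and \<open>v\<close> is the pair of arcs from \<open>u\<close> to \<open>v\<close> and from \<open>v\<close> to \<open>u\<close>.  Directing every edge means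
  keeping exactly one arc of each such pair and all vertices.  Since subgraphs inherit the tail and
  head functions, an orientation of \<open>G\<close> is determined by the arcs it keeps.
\<close>

definition orientation :: "('a, 'b) pre_digraph \<Rightarrow> ('a, 'b) pre_digraph \<Rightarrow> bool" where
  "orientation D G \<longleftrightarrow> spanning D G \<and>
     (\<forall>u v. u \<rightarrow>\<^bsub>G\<^esub> v \<longrightarrow> (u \<rightarrow>\<^bsub>D\<^esub> v) \<noteq> (v \<rightarrow>\<^bsub>D\<^esub> u))"

definition acyclic_orientations :: "('a, 'b) pre_digraph \<Rightarrow> ('a, 'b) pre_digraph set" where
  "acyclic_orientations G = {D. orientation D G \<and> \<not> (\<exists>p. pre_digraph.cycle D p)}"

definition zero_one_mat :: "nat mat \<Rightarrow> bool" where
  "zero_one_mat A \<longleftrightarrow> elements_mat A \<subseteq> {0, 1}"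

definition row_sum :: "nat mat \<Rightarrow> nat \<Rightarrow> nat" where
  "row_sum A i = (\<Sum>j<dim_col A. A $$ (i, j))"

definition col_sum :: "nat mat \<Rightarrow> nat \<Rightarrow> nat" where
  "col_sum A j = (\<Sum>i<dim_row A. A $$ (i, j))"

definition lonesum_mat :: "nat mat \<Rightarrow> bool" where
  "lonesum_mat A \<longleftrightarrow> zero_one_mat A \<and>
     (\<forall>B \<in> carrier_mat (dim_row A) (dim_col A).
        zero_one_mat B \<and>
        (\<forall>i<dim_row A. row_sum B i = row_sum A i) \<and>
        (\<forall>j<dim_col A. col_sum B j = col_sum A j) \<longrightarrow> B = A)"

text \<open>
  The library's \<open>K\<^bsub>m,n\<^esub>\<close> is a predicate that holds of every copy of the complete bipartite graph.
  Such copies exist for all \<open>m\<close> and \<open>n\<close>: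
\<close>

lemma complete_bipartite_exists:
  "\<exists>G :: (nat + nat, (nat + nat) \<times> (nat + nat)) pre_digraph. K\<^bsub>m,n\<^esub> G"
proof -
  let ?U = "Inl ` {..<m} :: (nat + nat) set" and ?V = "Inr ` {..<n} :: (nat + nat) set"
  let ?P = "\<lparr>pverts = ?U \<union> ?V, parcs = ?U \<times> ?V \<union> ?V \<times> ?U\<rparr>"
  have "card ?U = m" "card ?V = n" "?U \<inter> ?V = {}"
    by (auto simp: card_image)
  then have "K\<^bsub>m,n\<^esub> (with_proj ?P)"
    unfolding complete_bipartite_digraph_pair_def
    by (intro conjI exI[of _ ?U] exI[of _ ?V]) auto
  then show ?thesis by blast
qed

end

theory Submission
  imports Defs
begin

text \<open>
  An orientation \<open>D\<close> of \<open>K\<^bsub>m,n\<^esub>\<close> with parts \<open>u\<^sub>0, u\<^sub>1, \<dots>\<close> and \<open>v\<^sub>0, v\<^sub>1, \<dots>\<close> is the same thing as a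
  zero-one matrix: entry \<open>(i, j)\<close> says whether the edge between \<open>u\<^sub>i\<close> and \<open>v\<^sub>j\<close> points towards \<open>v\<^sub>j\<close>.
  The theorem holds because this bijection matches acyclic orientations with lonesum matrices.

  The two properties are linked by a third one.  A digraph is acyclic iff its vertices carry
  heights that drop along every arc.  For \<open>D\<close>, such heights are numbers \<open>f i\<close> for the rows and
  \<open>g j\<close> for the columns with \<open>f i > g j\<close> where the matrix has a one and \<open>f i < g j\<close> where it has a
  zero; they are said to separate the matrix.  It remains to see that a zero-one matrix is
  separated by some heights iff it is lonesum.

  If \<open>f\<close> and \<open>g\<close> separate \<open>A\<close>, weight the entry \<open>(i, j)\<close> by \<open>f i - g j\<close>.  The weight is positive at
  the ones of \<open>A\<close> and negative at its zeros, so \<open>A\<close> is the only zero-one matrix of maximal total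
  weight.  But the total weight depends on the row and column sums alone, so no other zero-one
  matrix shares those sums (\<open>lonesum_mat_if_separates\<close>).

  Conversely, a lonesum matrix has no two rows and two columns in which it restricts to a
  permutation matrix, since swapping the two columns there would preserve all sums
  (\<open>lonesum_mat_no_interchange\<close>).  Hence the supports of its rows form a chain under inclusion,
  and the position in that chain provides the heights (\<open>lonesum_mat_separable\<close>).
\<close>

section \<open>Zero-one matrices determined by their margins\<close>

lemma zero_one_mat_iff:
  "zero_one_mat A \<longleftrightarrow> (\<forall>i<dim_row A. \<forall>j<dim_col A. A $$ (i, j) = 0 \<or> A $$ (i, j) = 1)"
  unfolding zero_one_mat_def by (fastforce intro: elements_matI[OF carrier_matI])

definition separates :: "(nat \<Rightarrow> nat) \<Rightarrow> (nat \<Rightarrow> nat) \<Rightarrow> nat mat \<Rightarrow> bool" where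
  "separates f g A \<longleftrightarrow>
     (\<forall>i<dim_row A. \<forall>j<dim_col A. if A $$ (i, j) = 1 then g j < f i else f i < g j)"

text \<open>
  If \<open>B\<close> has the sums of \<open>A\<close>, then all row and column sums of \<open>d = A - B\<close> vanish, and therefore so
  does the total of \<open>d i j * (f i - g j)\<close>.  Where \<open>A\<close> and \<open>B\<close> differ, \<open>d i j\<close> has the sign of
  \<open>f i - g j\<close>, so every summand is nonnegative, and strictly positive at each disagreement.
\<close>

lemma lonesum_mat_if_separates:
  assumes A: "zero_one_mat A" and sep: "separates f g A"
  shows "lonesum_mat A"
  unfolding lonesum_mat_def
proof (intro conjI ballI impI)
  fix B
  assume BC: "B \<in> carrier_mat (dim_row A) (dim_col A)"
    and "zero_one_mat B \<and> (\<forall>i<dim_row A. row_sum B i = row_sum A i) \<and>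
         (\<forall>j<dim_col A. col_sum B j = col_sum A j)"
  then have B: "zero_one_mat B" and rows: "\<And>i. i < dim_row A \<Longrightarrow> row_sum B i = row_sum A i"
    and cols: "\<And>j. j < dim_col A \<Longrightarrow> col_sum B j = col_sum A j"
    by auto
  define m n where "m = dim_row A" and "n = dim_col A"
  have dims: "dim_row B = m" "dim_col B = n"
    using BC by (auto simp: m_def n_def)
  define d where "d i j = int (A $$ (i, j)) - int (B $$ (i, j))" for i j
  define t where "t i j = d i j * (int (f i) - int (g j))" for i j
  have d_row: "(\<Sum>j<n. d i j) = 0" if "i < m" for i
    using rows[of i] that dims
    by (simp add: d_def row_sum_def sum_subtractf m_def n_def flip: of_nat_sum)
  have d_col: "(\<Sum>i<m. d i j) = 0" if "j < n" for j
    using cols[of j] that dims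
    by (simp add: d_def col_sum_def sum_subtractf m_def n_def flip: of_nat_sum)
  have "(\<Sum>i<m. \<Sum>j<n. t i j)
      = (\<Sum>i<m. int (f i) * (\<Sum>j<n. d i j)) - (\<Sum>i<m. \<Sum>j<n. d i j * int (g j))"
    by (simp add: t_def right_diff_distrib sum_subtractf sum_distrib_left mult.commute)
  also have "(\<Sum>i<m. \<Sum>j<n. d i j * int (g j)) = (\<Sum>j<n. (\<Sum>i<m. d i j) * int (g j))"
    by (subst sum.swap) (simp add: sum_distrib_right)
  finally have total: "(\<Sum>i<m. \<Sum>j<n. t i j) = 0"
    using d_row d_col by simp
  have entry: "t i j \<ge> 0 \<and> (t i j = 0 \<longrightarrow> B $$ (i, j) = A $$ (i, j))" if "i < m" "j < n" for i j
  proof -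
    have "A $$ (i, j) = 0 \<or> A $$ (i, j) = 1" "B $$ (i, j) = 0 \<or> B $$ (i, j) = 1"
      using A B that dims unfolding zero_one_mat_iff m_def n_def by auto
    moreover have "if A $$ (i, j) = 1 then g j < f i else f i < g j"
      using sep that unfolding separates_def m_def n_def by blast
    ultimately show ?thesis
      by (auto simp: t_def d_def split: if_splits)
  qed
  have "t i j = 0" if "i < m" "j < n" for i j
  proof -
    have "\<forall>i\<in>{..<m}. (\<Sum>j<n. t i j) = 0"
      using total entry by (subst sum_nonneg_eq_0_iff[symmetric]) (auto intro: sum_nonneg)
    with \<open>i < m\<close> have "(\<Sum>j<n. t i j) = 0"
      by blast
    then have "\<forall>j\<in>{..<n}. t i j = 0"
      using entry \<open>i < m\<close> by (subst sum_nonneg_eq_0_iff[symmetric]) auto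
    with \<open>j < n\<close> show ?thesis
      by blast
  qed
  then show "B = A"
    using entry dims by (intro eq_matI) (auto simp: m_def n_def)
qed (fact A)

text \<open>
  Exchanging the two diagonals of such a two-by-two submatrix gives a different zero-one matrix.
  Inside rows \<open>i\<close> and \<open>i'\<close> it acts as a transposition of columns, and inside columns \<open>j\<close> and \<open>j'\<close>
  as a transposition of rows, so each affected sum is merely reindexed.
\<close>

lemma lonesum_mat_no_interchange:
  assumes "lonesum_mat A"
    and i: "i < dim_row A" "i' < dim_row A" and j: "j < dim_col A" "j' < dim_col A"
    and ones: "A $$ (i, j) = 1" "A $$ (i', j') = 1"
    and zeros: "A $$ (i, j') = 0" "A $$ (i', j) = 0"
  shows False
proof -
  define \<sigma> \<tau> where "\<sigma> = transpose i i'" and "\<tau> = transpose j j'"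
  define B where "B = mat (dim_row A) (dim_col A)
    (\<lambda>(k, l). if k \<in> {i, i'} then A $$ (k, \<tau> l) else A $$ (k, l))"
  have \<sigma>: "\<sigma> permutes {..<dim_row A}" and \<tau>: "\<tau> permutes {..<dim_col A}"
    using i j by (auto simp: \<sigma>_def \<tau>_def intro: permutes_swap_id)
  have \<tau>_less: "\<tau> l < dim_col A" if "l < dim_col A" for l
    using permutes_in_image[OF \<tau>, of l] that by simp
  have dims: "dim_row B = dim_row A" "dim_col B = dim_col A"
    by (simp_all add: B_def)
  have "zero_one_mat A"
    using assms(1) by (simp add: lonesum_mat_def)
  then have "zero_one_mat B"
    using \<tau>_less unfolding zero_one_mat_iff by (auto simp: B_def)
  moreover have "row_sum B k = row_sum A k" if "k < dim_row A" for k
  proof (cases "k \<in> {i, i'}")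
    case True
    have "row_sum B k = (\<Sum>l<dim_col A. A $$ (k, \<tau> l))"
      using True that by (auto simp: row_sum_def B_def)
    also have "\<dots> = row_sum A k"
      using sum.permute[OF \<tau>, of "\<lambda>l. A $$ (k, l)"] by (simp add: row_sum_def o_def)
    finally show ?thesis .
  next
    case False
    then show ?thesis
      using that by (simp add: row_sum_def B_def)
  qed
  moreover have "col_sum B l = col_sum A l" if "l < dim_col A" for l
  proof (cases "l \<in> {j, j'}")
    case True
    have "B $$ (k, l) = A $$ (\<sigma> k, l)" if "k < dim_row A" for k
      using True that \<open>l < dim_col A\<close> ones zeros
      by (auto simp: B_def \<sigma>_def \<tau>_def transpose_def)
    then have "col_sum B l = (\<Sum>k<dim_row A. A $$ (\<sigma> k, l))"
      by (simp add: col_sum_def dims)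
    also have "\<dots> = col_sum A l"
      using sum.permute[OF \<sigma>, of "\<lambda>k. A $$ (k, l)"] by (simp add: col_sum_def o_def)
    finally show ?thesis .
  next
    case False
    then have "\<tau> l = l"
      by (simp add: \<tau>_def transpose_def)
    then have "B $$ (k, l) = A $$ (k, l)" if "k < dim_row A" for k
      using that \<open>l < dim_col A\<close> by (simp add: B_def)
    then show ?thesis
      by (simp add: col_sum_def dims)
  qed
  moreover have "B \<in> carrier_mat (dim_row A) (dim_col A)"
    by (simp add: B_def)
  ultimately have "B = A"
    using assms(1) unfolding lonesum_mat_def by blast
  moreover have "B $$ (i, j) = 0"
    using i j zeros by (simp add: B_def \<tau>_def)
  ultimately show False
    using ones by simp
qed

text \<open>
  Let \<open>row i\<close> be the support of row \<open>i\<close>, and let \<open>low j\<close> be the union of the supports of all rows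
  that vanish in column \<open>j\<close>.  If row \<open>i\<close> has a zero in column \<open>j\<close>, then \<open>row i \<subseteq> low j\<close> by definition.
  If it has a one there, the absence of interchanges forces every row vanishing in column \<open>j\<close> to
  have its support inside \<open>row i\<close>, so \<open>low j \<subset> row i\<close>, strictly because \<open>j\<close> belongs to \<open>row i\<close> only.
  Cardinalities thus give the right comparison up to ties; doubling them and adding one on the
  column side breaks the ties.
\<close>

lemma lonesum_mat_separable:
  assumes "lonesum_mat A"
  obtains f g where "separates f g A"
proof -
  define row where "row i = {j. j < dim_col A \<and> A $$ (i, j) = 1}" for i
  define low where "low j = (\<Union>i\<in>{i. i < dim_row A \<and> A $$ (i, j) \<noteq> 1}. row i)" for j
  have fin: "finite (row i)" "finite (low j)" for i j
    by (auto simp: row_def low_def)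
  have zo: "A $$ (i, j) = 0" if "i < dim_row A" "j < dim_col A" "A $$ (i, j) \<noteq> 1" for i j
    using assms that unfolding lonesum_mat_def zero_one_mat_iff by blast
  have "separates (\<lambda>i. 2 * card (row i)) (\<lambda>j. 2 * card (low j) + 1) A"
    unfolding separates_def
  proof (intro allI impI)
    fix i j
    assume i: "i < dim_row A" and j: "j < dim_col A"
    show "if A $$ (i, j) = 1 then 2 * card (low j) + 1 < 2 * card (row i)
          else 2 * card (row i) < 2 * card (low j) + 1"
    proof (cases "A $$ (i, j) = 1")
      case True
      have "low j \<subseteq> row i"
      proof
        fix l
        assume "l \<in> low j"
        then obtain k where k: "k < dim_row A" "A $$ (k, j) \<noteq> 1" and l: "l < dim_col A" "A $$ (k, l) = 1"
          by (auto simp: low_def row_def)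
        show "l \<in> row i"
          using lonesum_mat_no_interchange[OF assms i k(1) j l(1) True l(2)]
            zo[OF i l(1)] zo[OF k(1) j k(2)] l(1)
          unfolding row_def by (metis (mono_tags, lifting) mem_Collect_eq)
      qed
      moreover have "j \<in> row i" "j \<notin> low j"
        using True j by (auto simp: row_def low_def)
      ultimately have "card (low j) < card (row i)"
        using fin by (intro psubset_card_mono) auto
      then show ?thesis
        using True by simp
    next
      case False
      then have "row i \<subseteq> low j"
        using i by (auto simp: low_def)
      then have "card (row i) \<le> card (low j)"
        using fin by (intro card_mono)
      then show ?thesis
        using False by simp
    qed
  qed
  then show thesis
    by (rule that)
qed

section \<open>Acyclic digraphs\<close>

lemma (in wf_digraph) ex_cycle_iff: "(\<exists>p. cycle p) \<longleftrightarrow> \<not> acyclic (arcs_ends G)"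
proof -
  have "(\<exists>p. cycle p) \<longleftrightarrow> (\<exists>p. closed_w p)"
    using closed_w_imp_cycle by (auto simp: cycle_altdef)
  also have "\<dots> \<longleftrightarrow> \<not> acyclic (arcs_ends G)"
    by (auto simp: closed_w_def acyclic_def reachable1_awalk)
  finally show ?thesis .
qed

text \<open>
  Counting descendants provides the heights of an acyclic digraph: everything below \<open>y\<close> is also
  below \<open>x\<close>, and \<open>y\<close> itself is below \<open>x\<close> but, by acyclicity, not below \<open>y\<close>.
\<close>

lemma acyclic_card_descendants_less:
  assumes "finite r" "acyclic r" "(x, y) \<in> r"
  shows "card (r\<^sup>+ `` {y}) < card (r\<^sup>+ `` {x})"
proof (rule psubset_card_mono)
  show "finite (r\<^sup>+ `` {x})"
    using assms(1) by (auto intro: finite_Image)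
  have "r\<^sup>+ `` {y} \<subseteq> r\<^sup>+ `` {x}"
    using assms(3) by (auto intro: trancl_into_trancl2)
  moreover have "y \<in> r\<^sup>+ `` {x}" "y \<notin> r\<^sup>+ `` {y}"
    using assms(2,3) by (auto simp: acyclic_def)
  ultimately show "r\<^sup>+ `` {y} \<subset> r\<^sup>+ `` {x}"
    by blast
qed

section \<open>Orientations of the complete bipartite graph\<close>

text \<open>
  Numbering the vertices of the two parts fixes which vertex belongs to which row or column, and
  so the correspondence with matrices.
\<close>

locale labelled_complete_bipartite = graph G for G :: "('a, 'b) pre_digraph" +
  fixes m n :: nat and u v :: "nat \<Rightarrow> 'a"
  assumes inj_u: "inj_on u {..<m}" and inj_v: "inj_on v {..<n}"
    and parts_disjoint: "u ` {..<m} \<inter> v ` {..<n} = {}"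
    and ends: "arcs_ends G = u ` {..<m} \<times> v ` {..<n} \<union> v ` {..<n} \<times> u ` {..<m}"
begin

definition biadjacency :: "('a, 'b) pre_digraph \<Rightarrow> nat mat" where
  "biadjacency D = mat m n (\<lambda>(i, j). if u i \<rightarrow>\<^bsub>D\<^esub> v j then 1 else 0)"

lemma biadjacency_simps [simp]:
  "dim_row (biadjacency D) = m" "dim_col (biadjacency D) = n"
  "i < m \<Longrightarrow> j < n \<Longrightarrow> biadjacency D $$ (i, j) = (if u i \<rightarrow>\<^bsub>D\<^esub> v j then 1 else 0)"
  by (simp_all add: biadjacency_def)

lemma zero_one_mat_biadjacency: "zero_one_mat (biadjacency D)"
  by (simp add: zero_one_mat_iff)

lemma orientationD:
  assumes "orientation D G"
  shows "wf_digraph D" "verts D = verts G" "arcs D \<subseteq> arcs G" "tail D = tail G" "head D = head G"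
    "arcs_ends D \<subseteq> arcs_ends G"
    "i < m \<Longrightarrow> j < n \<Longrightarrow> v j \<rightarrow>\<^bsub>D\<^esub> u i \<longleftrightarrow> \<not> u i \<rightarrow>\<^bsub>D\<^esub> v j"
proof -
  have *: "spanning D G" and one: "\<And>x y. x \<rightarrow>\<^bsub>G\<^esub> y \<Longrightarrow> (x \<rightarrow>\<^bsub>D\<^esub> y) \<noteq> (y \<rightarrow>\<^bsub>D\<^esub> x)"
    using assms by (auto simp: orientation_def)
  show "wf_digraph D" "verts D = verts G" "arcs D \<subseteq> arcs G" "tail D = tail G" "head D = head G"
    using * by (auto simp: spanning_def subgraph_def compatible_def)
  then show "arcs_ends D \<subseteq> arcs_ends G"
    by (auto simp: arcs_ends_conv)
  show "v j \<rightarrow>\<^bsub>D\<^esub> u i \<longleftrightarrow> \<not> u i \<rightarrow>\<^bsub>D\<^esub> v j" if "i < m" "j < n"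
    using one[of "u i" "v j"] that ends by auto
qed

text \<open>
  The heights of rows and columns transfer to the vertices, where every arc strictly decreases
  them; hence no nonempty walk can return to its start.
\<close>

lemma acyclic_if_separates_biadjacency:
  assumes D: "orientation D G" and sep: "separates f g (biadjacency D)"
  shows "acyclic (arcs_ends D)"
proof -
  define h where "h x = (if x \<in> u ` {..<m} then f (the_inv_into {..<m} u x)
    else g (the_inv_into {..<n} v x))" for x
  have h: "h (u i) = f i" "h (v j) = g j" if "i < m" "j < n" for i j
    using that inj_u inj_v parts_disjoint by (auto simp: h_def the_inv_into_f_f)
  have s: "if u i \<rightarrow>\<^bsub>D\<^esub> v j then g j < f i else f i < g j" if "i < m" "j < n" for i j
    using sep that by (simp add: separates_def split: if_splits)
  have "arcs_ends D \<subseteq> (measure h)\<inverse>"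
  proof
    fix a
    assume a: "a \<in> arcs_ends D"
    then have "a \<in> arcs_ends G"
      using orientationD(6)[OF D] by blast
    then obtain i j where ij: "i < m" "j < n" and "a = (u i, v j) \<or> a = (v j, u i)"
      by (auto simp: ends)
    then show "a \<in> (measure h)\<inverse>"
      using a s[OF ij] h[OF ij] orientationD(7)[OF D ij] by auto
  qed
  moreover have "acyclic ((measure h)\<inverse>)"
    by (simp add: acyclic_converse wf_acyclic)
  ultimately show ?thesis
    by (metis acyclic_subset)
qed

lemma separates_biadjacency_if_acyclic:
  assumes D: "orientation D G" and "acyclic (arcs_ends D)"
  obtains f g where "separates f g (biadjacency D)"
proof -
  define h where "h x = card ((arcs_ends D)\<^sup>+ `` {x})" for x
  have "finite (arcs_ends D)"
    using finite_subset[OF orientationD(3)[OF D] finite_arcs] by (simp add: arcs_ends_def)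
  then have "h y < h x" if "x \<rightarrow>\<^bsub>D\<^esub> y" for x y
    unfolding h_def using assms(2) that by (rule acyclic_card_descendants_less)
  then have "separates (h \<circ> u) (h \<circ> v) (biadjacency D)"
    using orientationD(7)[OF D] by (simp add: separates_def)
  then show thesis
    by (rule that)
qed

lemma acyclic_iff_lonesum_biadjacency:
  assumes "orientation D G"
  shows "acyclic (arcs_ends D) \<longleftrightarrow> lonesum_mat (biadjacency D)"
  using assms zero_one_mat_biadjacency lonesum_mat_if_separates lonesum_mat_separable
    acyclic_if_separates_biadjacency separates_biadjacency_if_acyclic
  by metis

lemma acyclic_orientations_eq:
  "acyclic_orientations G = {D. orientation D G \<and> lonesum_mat (biadjacency D)}"
  using wf_digraph.ex_cycle_iff[OF orientationD(1)] acyclic_iff_lonesum_biadjacency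
  unfolding acyclic_orientations_def by blast

text \<open>
  The matrix records the ends of all arcs of an orientation, including those that leave a \<open>v j\<close>,
  because exactly one of the two directions of each edge is kept.  The ends in turn determine the
  arcs, since \<open>G\<close> has no parallel arcs.
\<close>

lemma inj_on_biadjacency: "inj_on biadjacency {D. orientation D G}"
proof (rule inj_onI)
  have subset: "arcs D \<subseteq> arcs E"
    if D: "orientation D G" and E: "orientation E G" and eq: "biadjacency D = biadjacency E" for D E
  proof
    fix a
    assume a: "a \<in> arcs D"
    have fwd: "u i \<rightarrow>\<^bsub>D\<^esub> v j \<longleftrightarrow> u i \<rightarrow>\<^bsub>E\<^esub> v j" if "i < m" "j < n" for i j
      using arg_cong[OF eq, of "\<lambda>A. A $$ (i, j)"] that by (simp split: if_splits)
    have aD: "arc_to_ends D a \<in> arcs_ends D"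
      using a by (simp add: arcs_ends_def)
    then obtain i j where ij: "i < m" "j < n"
      and "arc_to_ends D a = (u i, v j) \<or> arc_to_ends D a = (v j, u i)"
      using orientationD(6)[OF D] ends by auto
    then have "arc_to_ends D a \<in> arcs_ends E"
      using aD fwd[OF ij] orientationD(7)[OF D ij] orientationD(7)[OF E ij] by auto
    then obtain b where b: "b \<in> arcs E" "arc_to_ends D a = arc_to_ends E b"
      by (auto simp: arcs_ends_def)
    then have "arc_to_ends G a = arc_to_ends G b"
      using orientationD(4,5)[OF D] orientationD(4,5)[OF E] by (simp add: arc_to_ends_def)
    with a b(1) show "a \<in> arcs E"
      using no_multi_arcs orientationD(3)[OF D] orientationD(3)[OF E] by blast
  qed
  fix D E
  assume "D \<in> {D. orientation D G}" "E \<in> {D. orientation D G}" "biadjacency D = biadjacency E"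
  moreover from this have "arcs D = arcs E"
    by (intro subset_antisym subset) auto
  ultimately show "D = E"
    using orientationD(2,4,5)[of D] orientationD(2,4,5)[of E] by (intro pre_digraph.equality) auto
qed

lemma ex_orientation_biadjacency:
  assumes A: "A \<in> carrier_mat m n" "zero_one_mat A"
  obtains D where "orientation D G" "biadjacency D = A"
proof -
  define S where "S = {(u i, v j) | i j. i < m \<and> j < n \<and> A $$ (i, j) = 1}
    \<union> {(v j, u i) | i j. i < m \<and> j < n \<and> A $$ (i, j) \<noteq> 1}"
  define D where "D = G \<lparr>arcs := {a \<in> arcs G. arc_to_ends G a \<in> S}\<rparr>"
  have "S \<subseteq> arcs_ends G"
    by (auto simp: S_def ends)
  then have ends_D: "arcs_ends D = S"
    by (auto simp: arcs_ends_def D_def arc_to_ends_def)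
  have apart: "u i \<noteq> v j" if "i < m" "j < n" for i j
    using that parts_disjoint by blast
  have fwd: "u i \<rightarrow>\<^bsub>D\<^esub> v j \<longleftrightarrow> A $$ (i, j) = 1"
    and bwd: "v j \<rightarrow>\<^bsub>D\<^esub> u i \<longleftrightarrow> A $$ (i, j) \<noteq> 1" if "i < m" "j < n" for i j
    using that apart apart[symmetric]
    unfolding ends_D S_def by (auto simp: inj_on_eq_iff[OF inj_u] inj_on_eq_iff[OF inj_v])
  have "wf_digraph D"
    by unfold_locales (auto simp: D_def wellformed)
  then have "spanning D G"
    using wf_digraph by (auto simp: spanning_def subgraph_def compatible_def D_def)
  then have "orientation D G"
    using fwd bwd by (auto simp: orientation_def ends)
  moreover have "biadjacency D = A"
    using A fwd by (intro eq_matI) (auto simp: zero_one_mat_iff)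
  ultimately show thesis
    by (rule that)
qed

lemma bij_betw_biadjacency:
  "bij_betw biadjacency (acyclic_orientations G) {A \<in> carrier_mat m n. lonesum_mat A}"
  unfolding bij_betw_def acyclic_orientations_eq
proof (intro conjI subset_antisym subsetI)
  show "inj_on biadjacency {D. orientation D G \<and> lonesum_mat (biadjacency D)}"
    by (rule inj_on_subset[OF inj_on_biadjacency]) auto
next
  fix A
  assume "A \<in> {A \<in> carrier_mat m n. lonesum_mat A}"
  moreover from this obtain D where "orientation D G" "biadjacency D = A"
    using ex_orientation_biadjacency by (auto simp: lonesum_mat_def)
  ultimately show "A \<in> biadjacency ` {D. orientation D G \<and> lonesum_mat (biadjacency D)}"
    by auto
qed (auto simp: biadjacency_def)

end

theorem theorem3p5:
  fixes n1 n2 :: nat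
    and G :: "('a, 'b) pre_digraph"
  assumes "n1 \<ge> 1" and "n2 \<ge> 1"
    and "K\<^bsub>n1,n2\<^esub> G"
  shows "card (acyclic_orientations G) = card {A \<in> carrier_mat n1 n2. lonesum_mat A}"
proof -
  from assms(3) obtain U V where "graph G" and UV: "verts G = U \<union> V" "U \<inter> V = {}"
    and card: "card U = n1" "card V = n2" and arcs: "arcs_ends G = U \<times> V \<union> V \<times> U"
    unfolding complete_bipartite_digraph_def by blast
  then interpret graph G
    by simp
  have "finite U" "finite V"
    using finite_verts UV(1) by auto
  then obtain u v where "bij_betw u {..<n1} U" "bij_betw v {..<n2} V"
    using card by (metis bij_betw_from_nat_into_finite)
  then interpret labelled_complete_bipartite G n1 n2 u v
    using UV arcs by unfold_locales (auto simp: bij_betw_def)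
  show ?thesis
    using bij_betw_biadjacency by (rule bij_betw_same_card)
qed

end
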